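(* Let $X_1,\ldots,X_n$ be random vectors in $\mathbb{R}^p$ of the form $$X_i=Y_i+R_i\frac{Z_i}{\sqrt{p}},$$ and let $n$ and $p$ tend to infinity. Assume the following. (i) $\{Y_i\}_{i=1}^n$ has joint distribution $P_n$; $\{Z_i\}_{i=1}^n$ are i.i.d. random vectors in $\mathbb{R}^p$ with $\mathbf{E}(Z_i)=0$; $\{Y_i\}_{i=1}^n$ and $\{Z_i\}_{i=1}^n$ are independent; the real random variables $\{R_i\}_{i=1}^n$ are independent of $\{Z_i\}_{i=1}^n$. (ii) There is a deterministic sequence $R_\infty(p)\ge1$ such that $|R_i|\le R_\infty(p)$ for all $i$. (iii) There are constants $C,c_0,b>0$ independent of $p$ such that for every function $F:\mathbb{R}^p\to\mathbb{R}$ that is $1$-Lipschitz with respect to the Euclidean norm, with $\mu_F=\mathbf{E}(F(Z_i))$, one has $P(|F(Z_i)-\mu_F|>r)\le C\exp(-c_0r^b)$ for all $r>0$. (iv) $\nu=\mathbf{E}(\Vert Z_i\Vert_2^2)/p$ stays bounded as $p\to\infty$. (v) With $\mathcal{M}=\max_{i,j}|Y_i'Y_j|$ and $\mathcal{M}_p$ a (deterministic) real such that $P(\mathcal{M}\le\mathcal{M}_p)\to1$, there exists $\varepsilon>0$ such that $$\max\left(\mathcal{M}_p^{1/2},R_\infty(p)\right)\frac{R_\infty(p)\left(\log n+(\log n)^{\varepsilon}\right)^{1/b}}{\sqrt{p}}\to0.$$ Then $$\max_{i,j}\left|X_i'X_j-\left(Y_i'Y_j+\delta_{i,j}\,\nu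 R_i^2\right)\right|\to0\quad\text{in probability}.$$ Moreover, for $\eta>0$ let $$J_p(\eta)=\left[-\mathcal{M}_p-\eta-R_\infty^2(p)\nu,\ \mathcal{M}_p+\eta+R_\infty^2(p)\nu\right],$$ and let $\mathcal{F}_{C_1,J_p(\eta)}$ be the set of functions $f:\mathbb{R}\to\mathbb{R}$ such that $|f(x)-f(y)|\le C_1|x-y|$ for all $x,y\in J_p(\eta)$. For such $f$ let $M_f$ and $\widetilde{M}_f$ be the $n\times n$ matrices with entries $$M_f(i,j)=\frac1nf\left(X_i'X_j\right),\qquad \widetilde{M}_f(i,j)=\begin{cases}\frac1nf\left(Y_i'Y_j\right), & i\ne j,\\ \frac1nf\left(\Vert Y_i\Vert_2^2+\nu R_i^2\right), & i=j.\end{cases}$$ Then, for any $C_1>0$ and $\eta>0$, $$\lim_{n,p\to\infty}\ \sup_{f\in\mathcal{F}_{C_1,J_p(\eta)}}\Vert M_f-\widetilde{M}_f\Vert_F=0\quad\text{in probability}.$$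
   Context: $v'w$ denotes the Euclidean inner product of vectors $v,w\in\mathbb{R}^p$, $\Vert v\Vert_2$ the Euclidean norm, $\Vert M\Vert_F$ the Frobenius norm of a matrix, and $\delta_{i,j}$ the Kronecker delta. The maximum $\max_{i,j}$ is over all $1\le i,j\le n$, including $i=j$. Because the supremum over $f$ may fail to be measurable, its convergence to $0$ in probability means that there is a random variable that dominates it and goes to $0$ in probability (convergence in outer probability). The distributions of the $Y_i$, $Z_i$, $R_i$ may vary with $n$ and $p$. *)

theory Defs
  imports "HOL-Probability.Probability" "Jordan_Normal_Form.Matrix"
begin

text \<open>Since the dimension \<open>p\<close> varies along the sequence, \<open>\<real>\<^sup>p\<close> is modelled by the functions in
  \<open>{..<p} \<rightarrow>\<^sub>E UNIV\<close>, with the product Borel \<open>\<sigma>\<close>-algebra. The Euclidean norm of \<open>v\<close> is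
  \<open>L2_set v {..<p}\<close>.\<close>

abbreviation Rp :: "nat \<Rightarrow> (nat \<Rightarrow> real) measure" where
  "Rp p \<equiv> PiM {..<p} (\<lambda>_. borel)"

definition scal :: "nat \<Rightarrow> (nat \<Rightarrow> real) \<Rightarrow> (nat \<Rightarrow> real) \<Rightarrow> real" where
  "scal p v w = (\<Sum>l<p. v l * w l)"

definition euclid_1_lipschitz :: "nat \<Rightarrow> ((nat \<Rightarrow> real) \<Rightarrow> real) \<Rightarrow> bool" where
  "euclid_1_lipschitz p F \<longleftrightarrow>
     (\<forall>v\<in>{..<p} \<rightarrow>\<^sub>E UNIV. \<forall>w\<in>{..<p} \<rightarrow>\<^sub>E UNIV. \<bar>F v - F w\<bar> \<le> L2_set (\<lambda>l. v l - w l) {..<p})"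

text \<open>The predicate \<open>prob_space.indep_var\<close> of the library requires both variables to take values in
  the same type; this is the same notion for variables with values in different types.\<close>

definition indep_rvs ::
    "'a measure \<Rightarrow> 'b measure \<Rightarrow> ('a \<Rightarrow> 'b) \<Rightarrow> 'c measure \<Rightarrow> ('a \<Rightarrow> 'c) \<Rightarrow> bool" where
  "indep_rvs M S A T B \<longleftrightarrow>
     A \<in> measurable M S \<and> B \<in> measurable M T \<and>
     prob_space.indep_set M {A -` U \<inter> space M | U. U \<in> sets S} {B -` U \<inter> space M | U. U \<in> sets T}"

definition frobenius_norm :: "real mat \<Rightarrow> real" where
  "frobenius_norm A = sqrt (\<Sum>i<dim_row A. \<Sum>j<dim_col A. (A $$ (i, j))\<^sup>2)"

definition kernel_mat :: "nat \<Rightarrow> nat \<Rightarrow> (real \<Rightarrow> real) \<Rightarrow> (nat \<Rightarrow> nat \<Rightarrow> real) \<Rightarrow> real mat" where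
  "kernel_mat p n f x = mat n n (\<lambda>(i, j). 1 / real n * f (scal p (x i) (x j)))"

definition approx_kernel_mat ::
    "nat \<Rightarrow> nat \<Rightarrow> real \<Rightarrow> (real \<Rightarrow> real) \<Rightarrow> (nat \<Rightarrow> nat \<Rightarrow> real) \<Rightarrow> (nat \<Rightarrow> real) \<Rightarrow> real mat" where
  "approx_kernel_mat p n \<nu> f y r = mat n n (\<lambda>(i, j).
     if i \<noteq> j then 1 / real n * f (scal p (y i) (y j))
     else 1 / real n * f ((L2_set (y i) {..<p})\<^sup>2 + \<nu> * (r i)\<^sup>2))"

text \<open>The underlying probability space may change along the sequence. Extended real values are
  needed because a supremum over functions that are unconstrained outside an interval can be
  infinite.\<close>

definition tendsto_zero_in_prob :: "(nat \<Rightarrow> 'a measure) \<Rightarrow> (nat \<Rightarrow> 'a \<Rightarrow> ereal) \<Rightarrow> bool" where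
  "tendsto_zero_in_prob \<Omega> V \<longleftrightarrow>
     (\<forall>k. V k \<in> borel_measurable (\<Omega> k)) \<and>
     (\<forall>\<delta>>0. (\<lambda>k. measure (\<Omega> k) {\<omega> \<in> space (\<Omega> k). \<bar>V k \<omega>\<bar> > ereal \<delta>}) \<longlonglongrightarrow> 0)"

definition tendsto_zero_in_outer_prob ::
    "(nat \<Rightarrow> 'a measure) \<Rightarrow> (nat \<Rightarrow> 'a \<Rightarrow> ereal) \<Rightarrow> bool" where
  "tendsto_zero_in_outer_prob \<Omega> S \<longleftrightarrow>
     (\<exists>D. (\<forall>k. \<forall>\<omega>\<in>space (\<Omega> k). \<bar>S k \<omega>\<bar> \<le> D k \<omega>) \<and> tendsto_zero_in_prob \<Omega> D)"

end

theory Submission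
  imports Defs "HOL-Real_Asymp.Real_Asymp"
begin

text \<open>Expand \<open>X\<^sub>i'X\<^sub>j\<close> into \<open>Y\<^sub>i'Y\<^sub>j\<close>, two cross terms \<open>R\<^sub>j Y\<^sub>i'Z\<^sub>j / \<surd>p\<close> and \<open>R\<^sub>i Y\<^sub>j'Z\<^sub>i / \<surd>p\<close>, and
  \<open>R\<^sub>i R\<^sub>j Z\<^sub>i'Z\<^sub>j / p\<close>. By independence one may freeze \<open>Y\<^sub>i\<close> in a cross term, and \<open>Z\<^sub>j\<close> in \<open>Z\<^sub>i'Z\<^sub>j\<close> for
  \<open>i \<noteq> j\<close> (\<open>indep_var_prob_le\<close>). What remains is a centred linear functional of one \<open>Z\<close>, whose Lipschitz
  constant is the norm of the frozen vector, so that its absolute value exceeds \<open>s\<close> times this norm with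
  probability at most \<open>C exp (- c0 s\<^sup>b)\<close>. The norm of \<open>Z\<^sub>i\<close> is itself Lipschitz, so the same bound holds
  for a deviation of more than \<open>s\<close> from its mean, and the squared mean differs from \<open>\<nu> p\<close> by the variance of the norm, which is
  bounded independently of \<open>p\<close> (\<open>norm_Z_moments\<close>).

  Take \<open>s = \<tau> \<surd>p / (R\<^sub>\<infinity> max (\<surd>M\<^sub>p) R\<^sub>\<infinity>)\<close> with \<open>\<tau>\<close> small. When none of the \<open>3 n\<^sup>2\<close> deviations occurs and
  all \<open>\<bar>Y\<^sub>i'Y\<^sub>j\<bar>\<close> are at most \<open>M\<^sub>p\<close>, every entry of the Gram matrix is off by at most a constant multiple of \<open>\<tau>\<close> plus
  \<open>O (R\<^sub>\<infinity>\<^sup>2 / p)\<close> (\<open>approx_inner_error_le\<close>). The rate assumption says that \<open>s\<close> is eventually larger than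
  any multiple of \<open>(log n)\<^bsup>1/b\<^esup>\<close>, so the union bound \<open>3 n\<^sup>2 C exp (- c0 s\<^sup>b)\<close> is eventually at most
  \<open>3 C / n\<close>, and it also makes \<open>R\<^sub>\<infinity>\<^sup>2 / p\<close> vanish.

  For the kernel matrices, on the event where all \<open>\<bar>Y\<^sub>i'Y\<^sub>j\<bar>\<close> are at most \<open>M\<^sub>p\<close> and the Gram error is at most \<open>\<eta>\<close>, all
  arguments of \<open>f\<close> lie in the interval where \<open>f\<close> is Lipschitz, and the Frobenius norm is at most \<open>C\<^sub>1\<close>
  times the Gram error, uniformly in \<open>f\<close> (\<open>frobenius_kernel_diff_le\<close>).\<close>

section \<open>Independence\<close>

text \<open>Conditioning on the first of two independent variables: a bound that holds with the first
  variable frozen at any value holds for the pair.\<close>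

lemma (in prob_space) indep_var_prob_le:
  assumes ind: "indep_var S A T B"
    and E: "Measurable.pred (S \<Otimes>\<^sub>M T) (\<lambda>(a, b). E a b)"
    and q: "0 \<le> q" "\<And>a. a \<in> space S \<Longrightarrow> prob {\<omega> \<in> space M. E a (B \<omega>)} \<le> q"
  shows "prob {\<omega> \<in> space M. E (A \<omega>) (B \<omega>)} \<le> q"
proof -
  have A [measurable]: "random_variable S A" and B [measurable]: "random_variable T B"
    and joint: "distr M S A \<Otimes>\<^sub>M distr M T B = distr M (S \<Otimes>\<^sub>M T) (\<lambda>x. (A x, B x))"
    using ind unfolding indep_var_distribution_eq by auto
  interpret A: prob_space "distr M S A" by (rule prob_space_distr) fact
  interpret B: prob_space "distr M T B" by (rule prob_space_distr) fact
  define Q where "Q = {x \<in> space (S \<Otimes>\<^sub>M T). case x of (a, b) \<Rightarrow> E a b}"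
  have Q [measurable]: "Q \<in> sets (S \<Otimes>\<^sub>M T)"
    unfolding Q_def using E by (simp add: pred_def)
  have "{\<omega> \<in> space M. E (A \<omega>) (B \<omega>)} = (\<lambda>x. (A x, B x)) -` Q \<inter> space M"
    using measurable_space[OF A] measurable_space[OF B] by (auto simp: Q_def space_pair_measure)
  then have "emeasure M {\<omega> \<in> space M. E (A \<omega>) (B \<omega>)} = emeasure (distr M (S \<Otimes>\<^sub>M T) (\<lambda>x. (A x, B x))) Q"
    by (simp add: emeasure_distr)
  also have "\<dots> = (\<integral>\<^sup>+a. emeasure (distr M T B) (Pair a -` Q) \<partial>distr M S A)"
    unfolding joint[symmetric] using Q by (intro B.emeasure_pair_measure_alt) simp
  also have "\<dots> \<le> (\<integral>\<^sup>+a. ennreal q \<partial>distr M S A)"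
  proof (rule nn_integral_mono)
    fix a assume "a \<in> space (distr M S A)"
    hence a: "a \<in> space S" by simp
    have "{\<omega> \<in> space M. E a (B \<omega>)} = B -` (Pair a -` Q) \<inter> space M"
      using measurable_space[OF B] a by (auto simp: Q_def space_pair_measure)
    then have "emeasure (distr M T B) (Pair a -` Q) = emeasure M {\<omega> \<in> space M. E a (B \<omega>)}"
      using Q by (simp add: emeasure_distr sets_Pair1)
    also have "\<dots> \<le> ennreal q"
      unfolding emeasure_eq_measure using q(2)[OF a] by (rule ennreal_leI)
    finally show "emeasure (distr M T B) (Pair a -` Q) \<le> ennreal q" .
  qed
  also have "\<dots> = ennreal q" using A.emeasure_space_1 by simp
  finally show ?thesis
    unfolding emeasure_eq_measure using q(1) by simp
qed

section \<open>Lipschitz functions and exponential concentration\<close>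

lemma abs_scal_le: "\<bar>scal p v w\<bar> \<le> L2_set v {..<p} * L2_set w {..<p}"
  unfolding scal_def
  by (rule order_trans[OF sum_abs order_trans[OF _ L2_set_mult_ineq]]) (simp add: abs_mult)

lemma scal_self: "scal p v v = (L2_set v {..<p})\<^sup>2"
  by (simp add: scal_def L2_set_def sum_nonneg power2_eq_square)

lemma scal_commute: "scal p v w = scal p w v"
  by (simp add: scal_def mult.commute)

lemma lipschitz_L2_set: "euclid_1_lipschitz p (\<lambda>v. L2_set v {..<p})"
  unfolding euclid_1_lipschitz_def
proof (intro ballI)
  fix v w :: "nat \<Rightarrow> real"
  have "L2_set v {..<p} \<le> L2_set w {..<p} + L2_set (\<lambda>l. v l - w l) {..<p}"
    using L2_set_triangle_ineq[of w "\<lambda>l. v l - w l"] by simp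
  moreover have "L2_set w {..<p} \<le> L2_set v {..<p} + L2_set (\<lambda>l. w l - v l) {..<p}"
    using L2_set_triangle_ineq[of v "\<lambda>l. w l - v l"] by simp
  moreover have "L2_set (\<lambda>l. w l - v l) {..<p} = L2_set (\<lambda>l. v l - w l) {..<p}"
    by (simp add: L2_set_def power2_commute)
  ultimately show "\<bar>L2_set v {..<p} - L2_set w {..<p}\<bar> \<le> L2_set (\<lambda>l. v l - w l) {..<p}"
    by linarith
qed

lemma lipschitz_scal:
  assumes "L2_set y {..<p} > 0"
  shows "euclid_1_lipschitz p (\<lambda>v. scal p y v / L2_set y {..<p})"
  unfolding euclid_1_lipschitz_def
proof (intro ballI)
  fix v w :: "nat \<Rightarrow> real"
  have "scal p y v - scal p y w = scal p y (\<lambda>l. v l - w l)"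
    by (simp add: scal_def right_diff_distrib sum_subtractf)
  then have "\<bar>scal p y v - scal p y w\<bar> \<le> L2_set y {..<p} * L2_set (\<lambda>l. v l - w l) {..<p}"
    using abs_scal_le by metis
  then show "\<bar>scal p y v / L2_set y {..<p} - scal p y w / L2_set y {..<p}\<bar>
      \<le> L2_set (\<lambda>l. v l - w l) {..<p}"
    using assms by (simp add: diff_divide_distrib[symmetric] abs_divide field_simps)
qed

lemma measurable_scal [measurable]:
  "(\<lambda>x. scal p (fst x) (snd x)) \<in> borel_measurable (Rp p \<Otimes>\<^sub>M Rp p)"
  unfolding scal_def by measurable

lemma measurable_scal_compose [measurable (raw)]:
  "f \<in> measurable M (Rp p) \<Longrightarrow> g \<in> measurable M (Rp p) \<Longrightarrow>
    (\<lambda>x. scal p (f x) (g x)) \<in> borel_measurable M"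
  using measurable_compose[OF measurable_Pair measurable_scal, of f M p g] by simp

lemma measurable_L2_set [measurable]: "(\<lambda>x. L2_set x {..<p}) \<in> borel_measurable (Rp p)"
  unfolding L2_set_def by measurable

lemma measurable_component_restrict:
  assumes "(\<lambda>\<omega>. \<lambda>i\<in>{..<n}. W i \<omega>) \<in> measurable M (PiM {..<n} (\<lambda>_. N))" "i < n"
  shows "W i \<in> measurable M N"
proof -
  have "(\<lambda>\<omega>. (\<lambda>i\<in>{..<n}. W i \<omega>) i) \<in> measurable M N"
    using assms(2) by (intro measurable_compose[OF assms(1)] measurable_component_singleton) simp
  then show ?thesis using assms(2) by simp
qed

text \<open>Concentration of the random vector \<open>W\<close> with rate \<open>C exp (- c r\<^sup>b)\<close>. Integrability of
  \<open>F W\<close> is part of the notion, as the mean would otherwise be a default value.\<close>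

definition exp_concentrated ::
    "'a measure \<Rightarrow> nat \<Rightarrow> real \<Rightarrow> real \<Rightarrow> real \<Rightarrow> ('a \<Rightarrow> nat \<Rightarrow> real) \<Rightarrow> bool" where
  "exp_concentrated M p C c b W \<longleftrightarrow> (\<forall>F. euclid_1_lipschitz p F \<longrightarrow>
     integrable M (\<lambda>\<omega>. F (W \<omega>)) \<and>
     (\<forall>r>0. measure M {\<omega> \<in> space M. \<bar>F (W \<omega>) - (\<integral>\<omega>'. F (W \<omega>') \<partial>M)\<bar> > r}
        \<le> C * exp (- c * r powr b)))"

text \<open>The threshold is proportional to the norm of \<open>y\<close>, so that \<open>y = 0\<close> needs no exception:
  the event is then empty.\<close>

lemma (in prob_space) prob_scal_le:
  assumes W: "exp_concentrated M p C c b W"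
    and mean: "\<And>l. l < p \<Longrightarrow> integrable M (\<lambda>\<omega>. W \<omega> l) \<and> (\<integral>\<omega>. W \<omega> l \<partial>M) = 0"
    and r: "r > 0" and C: "C > 0"
  shows "prob {\<omega> \<in> space M. \<bar>scal p y (W \<omega>)\<bar> > r * L2_set y {..<p}} \<le> C * exp (- c * r powr b)"
proof (cases "L2_set y {..<p} = 0")
  case True
  then have "scal p y v = 0" for v using abs_scal_le[of p y v] by simp
  with True C show ?thesis by simp
next
  case False
  then have pos: "L2_set y {..<p} > 0" using L2_set_nonneg[of y "{..<p}"] by linarith
  have "(\<integral>\<omega>. scal p y (W \<omega>) / L2_set y {..<p} \<partial>M) = 0"
    unfolding scal_def using mean by simp
  then have "prob {\<omega> \<in> space M. \<bar>scal p y (W \<omega>) / L2_set y {..<p}\<bar> > r} \<le> C * exp (- c * r powr b)"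
    using W lipschitz_scal[OF pos] r unfolding exp_concentrated_def by force
  also have "{\<omega> \<in> space M. \<bar>scal p y (W \<omega>) / L2_set y {..<p}\<bar> > r} =
      {\<omega> \<in> space M. \<bar>scal p y (W \<omega>)\<bar> > r * L2_set y {..<p}}"
    using pos by (simp add: abs_divide pos_less_divide_eq)
  finally show ?thesis .
qed

text \<open>An upper bound for the second moment of a real variable \<open>W\<close> with
  \<open>P (\<bar>W\<bar> > r) \<le> C exp (- c r\<^sup>b)\<close>, obtained by cutting the line at the positive integers:
  \<open>W\<^sup>2 \<le> 1 + (\<Sum>m. (m + 2)\<^sup>2 * 1(\<bar>W\<bar> > m + 1))\<close>. What matters is that it depends on \<open>C\<close>, \<open>c\<close>,
  \<open>b\<close> only, hence not on the dimension.\<close>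

definition tail_moment_bound :: "real \<Rightarrow> real \<Rightarrow> real \<Rightarrow> real" where
  "tail_moment_bound C c b = 1 + (\<Sum>m. (real m + 2)\<^sup>2 * (C * exp (- c * (real m + 1) powr b)))"

lemma summable_tail_moments:
  assumes "c > 0" "b > 0"
  shows "summable (\<lambda>m. (real m + 2)\<^sup>2 * (C * exp (- c * (real m + 1) powr b)))"
proof (rule summable_comparison_test_bigo)
  show "summable (\<lambda>m. norm (1 / real m ^ 2))"
    using inverse_power_summable[of 2, where 'a = real] by (simp add: field_simps)
  show "(\<lambda>m. (real m + 2)\<^sup>2 * (C * exp (- c * (real m + 1) powr b))) \<in> O(\<lambda>m. 1 / real m ^ 2)"
    using assms by real_asymp
qed

lemma (in prob_space) expectation_square_le_tail_moment_bound:
  fixes W :: "'a \<Rightarrow> real"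
  assumes [measurable]: "random_variable borel W"
    and tail: "\<And>r. r > 0 \<Longrightarrow> prob {\<omega> \<in> space M. \<bar>W \<omega>\<bar> > r} \<le> C * exp (- c * r powr b)"
    and C: "C > 0" and c: "c > 0" and b: "b > 0"
  shows "(\<integral>\<omega>. (W \<omega>)\<^sup>2 \<partial>M) \<le> tail_moment_bound C c b"
proof -
  let ?t = "\<lambda>m. (real m + 2)\<^sup>2 * (C * exp (- c * (real m + 1) powr b))"
  let ?I = "\<lambda>m \<omega>. ennreal ((real m + 2)\<^sup>2) * indicator {\<omega> \<in> space M. \<bar>W \<omega>\<bar> > real m + 1} \<omega>"
  have t: "summable ?t" "\<And>m. ?t m \<ge> 0" using summable_tail_moments[OF c b, of C] C by auto
  have pw: "ennreal ((W \<omega>)\<^sup>2) \<le> 1 + (\<Sum>m. ?I m \<omega>)" if "\<omega> \<in> space M" for \<omega>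
  proof (cases "\<bar>W \<omega>\<bar> \<le> 1")
    case True
    then have "(W \<omega>)\<^sup>2 \<le> 1" by (simp add: abs_square_le_1)
    then have "ennreal ((W \<omega>)\<^sup>2) \<le> 1" by (simp add: ennreal_le_1)
    then show ?thesis by (rule order_trans) simp
  next
    case False
    \<comment> \<open>The index with \<open>m + 1 < \<bar>W\<bar> \<le> m + 2\<close>; its term alone dominates \<open>W\<^sup>2\<close>.\<close>
    define m where "m = nat (\<lceil>\<bar>W \<omega>\<bar>\<rceil> - 2)"
    have "\<lceil>\<bar>W \<omega>\<bar>\<rceil> \<ge> 2" using False by linarith
    then have m: "real m = of_int \<lceil>\<bar>W \<omega>\<bar>\<rceil> - 2" unfolding m_def by simp
    have lo: "\<bar>W \<omega>\<bar> > real m + 1" and hi: "\<bar>W \<omega>\<bar> \<le> real m + 2" unfolding m by linarith+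
    have "(W \<omega>)\<^sup>2 \<le> (real m + 2)\<^sup>2" using hi by (metis abs_ge_zero power2_abs power_mono)
    then have "ennreal ((W \<omega>)\<^sup>2) \<le> ?I m \<omega>" using lo that by (simp add: ennreal_leI)
    also have "\<dots> \<le> (\<Sum>m. ?I m \<omega>)"
      using sum_le_suminf[OF summableI, of "{m}" "\<lambda>m. ?I m \<omega>"] by (simp del: sum_mult_indicator)
    also have "\<dots> \<le> 1 + (\<Sum>m. ?I m \<omega>)" by simp
    finally show ?thesis .
  qed
  have "(\<integral>\<^sup>+\<omega>. ennreal ((W \<omega>)\<^sup>2) \<partial>M) \<le> (\<integral>\<^sup>+\<omega>. 1 + (\<Sum>m. ?I m \<omega>) \<partial>M)"
    by (rule nn_integral_mono) (rule pw)
  also have "\<dots> = 1 + (\<Sum>m. \<integral>\<^sup>+\<omega>. ?I m \<omega> \<partial>M)"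
    by (subst nn_integral_add) (auto simp: nn_integral_suminf emeasure_space_1)
  also have "\<dots> = 1 + (\<Sum>m. ennreal ((real m + 2)\<^sup>2) * emeasure M {\<omega> \<in> space M. \<bar>W \<omega>\<bar> > real m + 1})"
    by (subst nn_integral_cmult_indicator) auto
  also have "\<dots> \<le> 1 + (\<Sum>m. ennreal (?t m))"
  proof (intro add_left_mono suminf_le)
    fix m
    have "ennreal ((real m + 2)\<^sup>2) * emeasure M {\<omega> \<in> space M. \<bar>W \<omega>\<bar> > real m + 1}
      = ennreal ((real m + 2)\<^sup>2 * prob {\<omega> \<in> space M. \<bar>W \<omega>\<bar> > real m + 1})"
      by (simp add: emeasure_eq_measure ennreal_mult)
    also have "\<dots> \<le> ennreal (?t m)"
      by (intro ennreal_leI mult_left_mono tail) auto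
    finally show "ennreal ((real m + 2)\<^sup>2) * emeasure M {\<omega> \<in> space M. \<bar>W \<omega>\<bar> > real m + 1} \<le> ennreal (?t m)" .
  qed auto
  also have "\<dots> = ennreal (tail_moment_bound C c b)"
    unfolding tail_moment_bound_def using t
    by (simp add: suminf_ennreal_eq summable_sums_iff suminf_nonneg flip: ennreal_1 ennreal_plus)
  finally have le: "(\<integral>\<^sup>+\<omega>. ennreal ((W \<omega>)\<^sup>2) \<partial>M) \<le> ennreal (tail_moment_bound C c b)" .
  have "tail_moment_bound C c b \<ge> 0"
    unfolding tail_moment_bound_def using suminf_nonneg[OF t] by simp
  then show ?thesis
    by (subst integral_eq_nn_integral) (use le in \<open>auto intro: enn2real_leI\<close>)
qed

section \<open>The error on a typical outcome\<close>

text \<open>The deterministic core. Expanding, with \<open>s\<close> the common size of the fluctuations,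
  \[ x_i'x_j = y_i'y_j + \frac{r_j}{\sqrt p} y_i'z_j + \frac{r_i}{\sqrt p} y_j'z_i
      + \frac{r_i r_j}{p} z_i'z_j . \]
  The cross terms are at most \<open>\<rho> s N / \<surd>p = \<tau>\<close> each. As \<open>m + \<surd>p \<le> K \<surd>p\<close> with \<open>K = 1 + \<surd>B\<close>, the last
  term is at most \<open>K \<tau>\<close> for \<open>i \<noteq> j\<close> and within \<open>2 K \<tau> + \<rho>\<^sup>2 V / p\<close> of \<open>\<nu> r\<^sub>i\<^sup>2\<close> for \<open>i = j\<close>. Here \<open>m\<close>
  stands for the mean of the norm of \<open>z\<^sub>j\<close>, and \<open>V\<close> for a bound on its variance, which is the gap
  between \<open>m\<^sup>2\<close> and the second moment \<open>\<nu> p\<close>.\<close>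

lemma approx_inner_error_le:
  fixes x y z :: "nat \<Rightarrow> nat \<Rightarrow> real" and r :: "nat \<Rightarrow> real"
  assumes p: "p \<ge> 1"
    and x: "\<And>k. k \<in> {i, j} \<Longrightarrow> x k = (\<lambda>l\<in>{..<p}. y k l + r k * (z k l / sqrt (real p)))"
    and r: "\<And>k. k \<in> {i, j} \<Longrightarrow> \<bar>r k\<bar> \<le> \<rho>"
    and \<rho>: "0 < \<rho>" "\<rho> \<le> N"
    and y: "\<And>k. k \<in> {i, j} \<Longrightarrow> L2_set (y k) {..<p} \<le> N"
    and \<tau>: "0 < \<tau>"
    and s: "s = \<tau> * sqrt (real p) / (\<rho> * N)" "s \<le> sqrt (real p)"
    and yz: "\<bar>scal p (y i) (z j)\<bar> \<le> s * L2_set (y i) {..<p}"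
            "\<bar>scal p (y j) (z i)\<bar> \<le> s * L2_set (y j) {..<p}"
    and zz: "i \<noteq> j \<Longrightarrow> \<bar>scal p (z i) (z j)\<bar> \<le> s * L2_set (z j) {..<p}"
    and zm: "\<bar>L2_set (z j) {..<p} - m\<bar> \<le> s"
    and m: "0 \<le> m" "m\<^sup>2 \<le> \<nu> * real p" "\<nu> * real p \<le> m\<^sup>2 + V"
    and \<nu>: "\<nu> \<le> B"
  shows "\<bar>scal p (x i) (x j) - (scal p (y i) (y j) + (if i = j then 1 else 0) * \<nu> * (r i)\<^sup>2)\<bar>
    \<le> 2 * \<tau> * (2 + sqrt B) + \<rho>\<^sup>2 * V / real p"
proof -
  define q where "q = sqrt (real p)"
  have q: "q > 0" "q * q = real p" using p by (auto simp: q_def)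
  have N: "N > 0" using \<rho> by linarith
  have s0: "s \<ge> 0" unfolding s using \<tau> \<rho> N by simp
  have V0: "V \<ge> 0" using m by linarith
  have "scal p (x i) (x j) = (\<Sum>l<p. (y i l + r i * (z i l / q)) * (y j l + r j * (z j l / q)))"
    unfolding scal_def using x by (intro sum.cong) (auto simp: q_def)
  also have "\<dots> = scal p (y i) (y j) + r j / q * scal p (y i) (z j) + r i / q * scal p (y j) (z i)
      + r i * r j / (q * q) * scal p (z i) (z j)"
    unfolding scal_def sum_distrib_left sum.distrib[symmetric]
    by (intro sum.cong refl) (simp add: algebra_simps)
  finally have expand: "scal p (x i) (x j) = scal p (y i) (y j) + r j / q * scal p (y i) (z j)
      + r i / q * scal p (y j) (z i) + r i * r j / real p * scal p (z i) (z j)"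
    by (simp add: q)
  have cross: "\<bar>a / q * t\<bar> \<le> \<tau>" if "\<bar>a\<bar> \<le> \<rho>" "\<bar>t\<bar> \<le> s * L" "L \<le> N" for a t L
  proof -
    have "\<bar>a / q * t\<bar> = \<bar>a\<bar> * \<bar>t\<bar> / q" using q by (simp add: abs_mult)
    also have "\<bar>t\<bar> \<le> s * N" using that s0 by (meson mult_left_mono order_trans)
    then have "\<bar>a\<bar> * \<bar>t\<bar> / q \<le> \<rho> * (s * N) / q"
      using that q \<rho> by (intro divide_right_mono mult_mono) auto
    also have "\<dots> = \<tau>" unfolding s using q \<rho> N by (simp add: q_def)
    finally show ?thesis .
  qed
  have c1: "\<bar>r j / q * scal p (y i) (z j)\<bar> \<le> \<tau>" by (rule cross[OF _ yz(1)]) (use r y in auto)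
  have c2: "\<bar>r i / q * scal p (y j) (z i)\<bar> \<le> \<tau>" by (rule cross[OF _ yz(2)]) (use r y in auto)
  \<comment> \<open>\<open>K q\<close> bounds both the norm of \<open>z\<^sub>j\<close> and half the sum of that norm and \<open>m\<close>.\<close>
  define K where "K = 1 + sqrt B"
  have "m\<^sup>2 \<le> B * real p" using m \<nu> by (meson mult_right_mono of_nat_0_le_iff order_trans)
  then have "m \<le> sqrt (B * real p)" using real_le_rsqrt by blast
  then have mK: "m + q \<le> K * q" by (simp add: K_def q_def real_sqrt_mult algebra_simps)
  have small: "\<bar>a\<bar> * (s * (K * q)) / real p \<le> K * \<tau>" if "\<bar>a\<bar> \<le> \<rho> * \<rho>" for a
  proof -
    have K0: "K * q \<ge> 0" using mK m q by linarith
    then have K1: "K \<ge> 0" using q(1) by (simp add: zero_le_mult_iff)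
    have "\<bar>a\<bar> * (s * (K * q)) / real p \<le> (\<rho> * \<rho>) * (s * (K * q)) / real p"
      using that s0 K0 by (intro divide_right_mono mult_right_mono) auto
    also have "\<dots> = K * \<tau> * (\<rho> / N)" unfolding s q(2)[symmetric] using p q \<rho> N
      by (simp add: field_simps flip: q_def)
    also have "\<dots> \<le> K * \<tau> * 1" using \<rho> N K1 \<tau> by (intro mult_left_mono) auto
    finally show ?thesis by simp
  qed
  have rr: "\<bar>r i * r j\<bar> \<le> \<rho> * \<rho>" "\<bar>r i * r i\<bar> \<le> \<rho> * \<rho>"
    unfolding abs_mult by (rule mult_mono; use r[of i] r[of j] \<rho> in simp)+
  have c3: "\<bar>r i * r j / real p * scal p (z i) (z j) - (if i = j then 1 else 0) * \<nu> * (r i)\<^sup>2\<bar>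
      \<le> 2 * (K * \<tau>) + \<rho>\<^sup>2 * V / real p"
  proof (cases "i = j")
    case False
    have "L2_set (z j) {..<p} \<le> K * q" using zm s(2) mK by (auto simp: q_def)
    then have "\<bar>scal p (z i) (z j)\<bar> \<le> s * (K * q)"
      using zz[OF False] s0 by (meson mult_left_mono order_trans)
    then have "\<bar>r i * r j\<bar> * \<bar>scal p (z i) (z j)\<bar> / real p \<le> \<bar>r i * r j\<bar> * (s * (K * q)) / real p"
      by (intro divide_right_mono mult_left_mono) auto
    also have "\<dots> \<le> K * \<tau>" by (rule small[OF rr(1)])
    finally have le: "\<bar>r i * r j / real p * scal p (z i) (z j)\<bar> \<le> K * \<tau>"
      by (simp add: abs_mult)
    have "0 \<le> \<rho>\<^sup>2 * V / real p" using V0 by simp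
    moreover have "0 \<le> K * \<tau>" using le by linarith
    ultimately show ?thesis using le False by simp
  next
    case True
    define L where "L = L2_set (z j) {..<p}"
    have L0: "L \<ge> 0" by (simp add: L_def)
    have "\<bar>L\<^sup>2 - m\<^sup>2\<bar> = \<bar>L - m\<bar> * (L + m)"
      using L0 m by (simp add: power2_eq_square square_diff_square_factored abs_mult)
    also have "\<dots> \<le> s * (2 * (K * q))"
      using zm s s0 mK m L0 by (intro mult_mono) (auto simp: L_def q_def)
    finally have Lm: "\<bar>L\<^sup>2 - \<nu> * real p\<bar> \<le> 2 * (s * (K * q)) + V"
      using m by linarith
    have "r i * r j / real p * scal p (z i) (z j) - (if i = j then 1 else 0) * \<nu> * (r i)\<^sup>2
        = (r i * r i) * (L\<^sup>2 - \<nu> * real p) / real p"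
      using True p by (simp add: scal_self L_def power2_eq_square field_simps)
    then have "\<bar>r i * r j / real p * scal p (z i) (z j) - (if i = j then 1 else 0) * \<nu> * (r i)\<^sup>2\<bar>
        = \<bar>r i * r i\<bar> * \<bar>L\<^sup>2 - \<nu> * real p\<bar> / real p"
      by (simp add: abs_mult)
    also have "\<dots> \<le> \<bar>r i * r i\<bar> * (2 * (s * (K * q)) + V) / real p"
      by (intro divide_right_mono mult_left_mono Lm) auto
    also have "\<dots> = 2 * (\<bar>r i * r i\<bar> * (s * (K * q)) / real p) + \<bar>r i * r i\<bar> * V / real p"
      by (simp add: distrib_left add_divide_distrib)
    also have "\<dots> \<le> 2 * (K * \<tau>) + \<rho> * \<rho> * V / real p"
      by (intro add_mono mult_left_mono small[OF rr(2)] divide_right_mono mult_right_mono rr(2) V0) auto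
    finally show ?thesis by (simp add: power2_eq_square)
  qed
  have "\<bar>scal p (x i) (x j) - (scal p (y i) (y j) + (if i = j then 1 else 0) * \<nu> * (r i)\<^sup>2)\<bar>
    \<le> \<tau> + \<tau> + (2 * (K * \<tau>) + \<rho>\<^sup>2 * V / real p)"
    unfolding expand using c1 c2 c3 by linarith
  also have "\<dots> = 2 * \<tau> * (2 + sqrt B) + \<rho>\<^sup>2 * V / real p"
    by (simp add: K_def algebra_simps)
  finally show ?thesis .
qed

text \<open>The largest absolute entry of the Gram matrix of \<open>y\<close>; it is meaningful for \<open>n \<ge> 1\<close>.\<close>

definition gram_max :: "nat \<Rightarrow> nat \<Rightarrow> (nat \<Rightarrow> nat \<Rightarrow> real) \<Rightarrow> real" where
  "gram_max p n y = (MAX (i, j)\<in>{..<n} \<times> {..<n}. \<bar>scal p (y i) (y j)\<bar>)"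

text \<open>The largest absolute entry of the Gram matrix of \<open>x\<close> minus its approximation: the Gram matrix
  of \<open>y\<close> with the diagonal corrected by \<open>\<nu> r\<^sub>i\<^sup>2\<close>; it is meaningful for \<open>n \<ge> 1\<close>.\<close>

definition gram_error ::
    "nat \<Rightarrow> nat \<Rightarrow> real \<Rightarrow> (nat \<Rightarrow> nat \<Rightarrow> real) \<Rightarrow> (nat \<Rightarrow> nat \<Rightarrow> real) \<Rightarrow> (nat \<Rightarrow> real) \<Rightarrow> real" where
  "gram_error p n \<nu> x y r = (MAX (i, j)\<in>{..<n} \<times> {..<n}.
     \<bar>scal p (x i) (x j) - (scal p (y i) (y j) + (if i = j then 1 else 0) * \<nu> * (r i)\<^sup>2)\<bar>)"

lemma gram_max_ge: "i < n \<Longrightarrow> j < n \<Longrightarrow> \<bar>scal p (y i) (y j)\<bar> \<le> gram_max p n y"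
  unfolding gram_max_def by (rule Max_ge) auto

lemma gram_error_ge: "i < n \<Longrightarrow> j < n \<Longrightarrow>
    \<bar>scal p (x i) (x j) - (scal p (y i) (y j) + (if i = j then 1 else 0) * \<nu> * (r i)\<^sup>2)\<bar>
      \<le> gram_error p n \<nu> x y r"
  unfolding gram_error_def by (rule Max_ge) (force intro: finite_imageI)+

lemma gram_error_le:
  assumes "n \<ge> 1"
    and "\<And>i j. i < n \<Longrightarrow> j < n \<Longrightarrow>
      \<bar>scal p (x i) (x j) - (scal p (y i) (y j) + (if i = j then 1 else 0) * \<nu> * (r i)\<^sup>2)\<bar> \<le> e"
  shows "gram_error p n \<nu> x y r \<le> e"
  unfolding gram_error_def using assms by (intro Max.boundedI) (auto simp: lessThan_empty_iff)

text \<open>All arguments of \<open>f\<close> lie in the interval where it is Lipschitz, so each of the \<open>n\<^sup>2\<close> entries of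
  the difference is at most \<open>C1 / n\<close> times the error of the Gram matrix.\<close>

lemma frobenius_kernel_diff_le:
  assumes n: "n \<ge> 1" and f: "C1-lipschitz_on {- A - \<eta> - \<rho>\<^sup>2 * \<nu> .. A + \<eta> + \<rho>\<^sup>2 * \<nu>} f"
    and r: "\<And>i. i < n \<Longrightarrow> \<bar>r i\<bar> \<le> \<rho>" and \<nu>: "\<nu> \<ge> 0" and \<eta>: "\<eta> \<ge> 0"
    and y: "gram_max p n y \<le> A" and e: "gram_error p n \<nu> x y r \<le> \<eta>"
  shows "frobenius_norm (kernel_mat p n f x - approx_kernel_mat p n \<nu> f y r)
      \<le> C1 * gram_error p n \<nu> x y r"
proof -
  define w where "w i j = scal p (y i) (y j) + (if i = j then 1 else 0) * \<nu> * (r i)\<^sup>2" for i j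
  let ?e = "gram_error p n \<nu> x y r"
  have C1: "C1 \<ge> 0" using f by (rule lipschitz_on_nonneg)
  have e0: "?e \<ge> 0" using gram_error_ge[of 0 n 0 p x y \<nu> r] n by linarith
  have entry: "\<bar>f (scal p (x i) (x j)) - f (w i j)\<bar> \<le> C1 * ?e" if ij: "i < n" "j < n" for i j
  proof -
    have xw: "\<bar>scal p (x i) (x j) - w i j\<bar> \<le> ?e"
      unfolding w_def using ij by (rule gram_error_ge)
    have "(r i)\<^sup>2 \<le> \<rho>\<^sup>2" using r[OF ij(1)] by (metis abs_ge_zero power2_abs power_mono)
    then have "\<nu> * (r i)\<^sup>2 \<le> \<nu> * \<rho>\<^sup>2" using \<nu> by (rule mult_left_mono)
    then have nr: "0 \<le> (if i = j then 1 else 0) * \<nu> * (r i)\<^sup>2"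
        "(if i = j then 1 else 0) * \<nu> * (r i)\<^sup>2 \<le> \<rho>\<^sup>2 * \<nu>"
      using \<nu> by (auto simp: mult.commute)
    have "\<bar>scal p (y i) (y j)\<bar> \<le> A" using gram_max_ge[OF ij, of p y] y by linarith
    then have "w i j \<in> {- A - \<eta> - \<rho>\<^sup>2 * \<nu> .. A + \<eta> + \<rho>\<^sup>2 * \<nu>}"
        "scal p (x i) (x j) \<in> {- A - \<eta> - \<rho>\<^sup>2 * \<nu> .. A + \<eta> + \<rho>\<^sup>2 * \<nu>}"
      using nr xw e \<eta> unfolding w_def by auto
    then have "dist (f (scal p (x i) (x j))) (f (w i j)) \<le> C1 * dist (scal p (x i) (x j)) (w i j)"
      using f by (intro lipschitz_onD) auto
    also have "\<dots> \<le> C1 * ?e" using xw C1 by (intro mult_left_mono) (auto simp: dist_real_def)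
    finally show ?thesis by (simp add: dist_real_def)
  qed
  have mat: "kernel_mat p n f x - approx_kernel_mat p n \<nu> f y r =
      mat n n (\<lambda>(i, j). (f (scal p (x i) (x j)) - f (w i j)) / real n)"
    unfolding kernel_mat_def approx_kernel_mat_def w_def
    by (rule eq_matI) (auto simp: scal_self diff_divide_distrib)
  have "(\<Sum>i<n. \<Sum>j<n. ((f (scal p (x i) (x j)) - f (w i j)) / real n)\<^sup>2)
      \<le> (\<Sum>i<n. \<Sum>j<n. (C1 * ?e / real n)\<^sup>2)"
  proof (intro sum_mono)
    fix i j assume "i \<in> {..<n}" "j \<in> {..<n}"
    then have "\<bar>(f (scal p (x i) (x j)) - f (w i j)) / real n\<bar> \<le> \<bar>C1 * ?e / real n\<bar>"
      using entry[of i j] C1 e0 by (simp add: divide_right_mono)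
    then show "((f (scal p (x i) (x j)) - f (w i j)) / real n)\<^sup>2 \<le> (C1 * ?e / real n)\<^sup>2"
      by (simp only: abs_le_square_iff)
  qed
  also have "\<dots> = (C1 * ?e)\<^sup>2" using n by (simp add: power2_eq_square field_simps)
  finally show ?thesis
    unfolding frobenius_norm_def mat using C1 e0 by (simp add: real_le_lsqrt sum_nonneg)
qed

section \<open>Probability of a large error for fixed dimension and sample size\<close>

text \<open>The model for one value of \<open>n\<close> and \<open>p\<close>. The variables \<open>R i\<close> enter only through
  measurability and the bound \<open>\<rho>\<close>.\<close>

locale noisy_vectors = prob_space M for M :: "'a measure" +
  fixes n p :: nat
    and X Y Z :: "nat \<Rightarrow> 'a \<Rightarrow> nat \<Rightarrow> real"
    and R :: "nat \<Rightarrow> 'a \<Rightarrow> real"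
    and \<rho> \<nu> C c b :: real
  assumes n: "n \<ge> 1" and p: "p \<ge> 1"
    and X: "\<And>i \<omega>. i < n \<Longrightarrow> \<omega> \<in> space M \<Longrightarrow>
        X i \<omega> = (\<lambda>l\<in>{..<p}. Y i \<omega> l + R i \<omega> * (Z i \<omega> l / sqrt (real p)))"
    and Z_indep: "indep_vars (\<lambda>_. Rp p) Z {..<n}"
    and Z_mean: "\<And>i l. i < n \<Longrightarrow> l < p \<Longrightarrow>
        integrable M (\<lambda>\<omega>. Z i \<omega> l) \<and> (\<integral>\<omega>. Z i \<omega> l \<partial>M) = 0"
    and Y_Z_indep: "indep_var
        (PiM {..<n} (\<lambda>_. Rp p)) (\<lambda>\<omega>. \<lambda>i\<in>{..<n}. Y i \<omega>)
        (PiM {..<n} (\<lambda>_. Rp p)) (\<lambda>\<omega>. \<lambda>i\<in>{..<n}. Z i \<omega>)"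
    and R_measurable: "\<And>i. i < n \<Longrightarrow> random_variable borel (R i)"
    and \<rho>: "\<rho> \<ge> 1"
    and R_bound: "\<And>i \<omega>. i < n \<Longrightarrow> \<omega> \<in> space M \<Longrightarrow> \<bar>R i \<omega>\<bar> \<le> \<rho>"
    and C: "C > 0" and c: "c > 0" and b: "b > 0"
    and Z_conc: "\<And>i. i < n \<Longrightarrow> exp_concentrated M p C c b (Z i)"
    and nu: "\<And>i. i < n \<Longrightarrow>
        integrable M (\<lambda>\<omega>. (L2_set (Z i \<omega>) {..<p})\<^sup>2) \<and>
        \<nu> = (\<integral>\<omega>. (L2_set (Z i \<omega>) {..<p})\<^sup>2 \<partial>M) / real p"
begin

lemma nu_nonneg: "\<nu> \<ge> 0"
  using nu[of 0] n by simp

lemma Z_measurable: "i < n \<Longrightarrow> random_variable (Rp p) (Z i)"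
  using Z_indep unfolding indep_vars_def by auto

lemma Y_measurable: "i < n \<Longrightarrow> random_variable (Rp p) (Y i)"
  using measurable_component_restrict indep_var_rv1[OF Y_Z_indep] by blast

lemma X_measurable: "i < n \<Longrightarrow> random_variable (Rp p) (X i)"
proof -
  assume i: "i < n"
  note [measurable] = Z_measurable[OF i] Y_measurable[OF i] R_measurable[OF i]
  have "random_variable (Rp p) (\<lambda>\<omega>. \<lambda>l\<in>{..<p}. Y i \<omega> l + R i \<omega> * (Z i \<omega> l / sqrt (real p)))"
    by measurable
  then show "random_variable (Rp p) (X i)"
    by (rule measurable_cong[THEN iffD2, rotated]) (rule X[OF i])
qed

lemma gram_max_measurable: "random_variable borel (\<lambda>\<omega>. gram_max p n (\<lambda>i. Y i \<omega>))"
proof -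
  have "random_variable borel (\<lambda>\<omega>. Max ((\<lambda>ij. \<bar>scal p (Y (fst ij) \<omega>) (Y (snd ij) \<omega>)\<bar>) ` ({..<n} \<times> {..<n})))"
    using Y_measurable by (intro borel_measurable_Max borel_measurable_abs measurable_scal_compose) auto
  then show ?thesis by (simp add: gram_max_def case_prod_unfold)
qed

lemma gram_error_measurable:
  "random_variable borel (\<lambda>\<omega>. gram_error p n \<nu> (\<lambda>i. X i \<omega>) (\<lambda>i. Y i \<omega>) (\<lambda>i. R i \<omega>))"
proof -
  have "random_variable borel (\<lambda>\<omega>. Max ((\<lambda>ij. \<bar>scal p (X (fst ij) \<omega>) (X (snd ij) \<omega>) -
      (scal p (Y (fst ij) \<omega>) (Y (snd ij) \<omega>) + (if fst ij = snd ij then 1 else 0) * \<nu> * (R (fst ij) \<omega>)\<^sup>2)\<bar>)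
      ` ({..<n} \<times> {..<n})))"
    using X_measurable Y_measurable R_measurable
    by (intro borel_measurable_Max borel_measurable_abs borel_measurable_diff borel_measurable_add
        borel_measurable_times borel_measurable_power measurable_scal_compose) auto
  then show ?thesis by (simp add: gram_error_def case_prod_unfold)
qed

text \<open>The outcomes where all the linear functionals and norms of the \<open>Z i\<close> that occur in the
  expansion of \<open>X\<^sub>i'X\<^sub>j\<close> deviate by at most \<open>s\<close>, relative to the Lipschitz constant.\<close>

definition typical :: "real \<Rightarrow> 'a set" where
  "typical s = {\<omega> \<in> space M. \<forall>i<n. \<forall>j<n.
     \<bar>scal p (Y i \<omega>) (Z j \<omega>)\<bar> \<le> s * L2_set (Y i \<omega>) {..<p} \<and>
     (i \<noteq> j \<longrightarrow> \<bar>scal p (Z i \<omega>) (Z j \<omega>)\<bar> \<le> s * L2_set (Z j \<omega>) {..<p}) \<and>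
     \<bar>L2_set (Z j \<omega>) {..<p} - (\<integral>\<omega>'. L2_set (Z j \<omega>') {..<p} \<partial>M)\<bar> \<le> s}"

lemma prob_YZ_le:
  assumes s: "s > 0" and i: "i < n" and j: "j < n"
  shows "prob {\<omega> \<in> space M. \<bar>scal p (Y i \<omega>) (Z j \<omega>)\<bar> > s * L2_set (Y i \<omega>) {..<p}}
    \<le> C * exp (- c * s powr b)"
proof -
  let ?P = "PiM {..<n} (\<lambda>_. Rp p)"
  have [measurable]: "(\<lambda>x. x i) \<in> measurable ?P (Rp p)" "(\<lambda>x. x j) \<in> measurable ?P (Rp p)"
    using i j by (auto intro: measurable_component_singleton)
  have "prob {\<omega> \<in> space M.
      \<bar>scal p ((\<lambda>i\<in>{..<n}. Y i \<omega>) i) ((\<lambda>i\<in>{..<n}. Z i \<omega>) j)\<bar> > s * L2_set ((\<lambda>i\<in>{..<n}. Y i \<omega>) i) {..<p}}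
    \<le> C * exp (- c * s powr b)"
  proof (rule indep_var_prob_le[OF Y_Z_indep,
        where E = "\<lambda>y z. \<bar>scal p (y i) (z j)\<bar> > s * L2_set (y i) {..<p}"])
    show "Measurable.pred (?P \<Otimes>\<^sub>M ?P) (\<lambda>(y, z). \<bar>scal p (y i) (z j)\<bar> > s * L2_set (y i) {..<p})"
      by measurable
    show "prob {\<omega> \<in> space M. \<bar>scal p (y i) ((\<lambda>i\<in>{..<n}. Z i \<omega>) j)\<bar> > s * L2_set (y i) {..<p}}
        \<le> C * exp (- c * s powr b)" for y
      using prob_scal_le[OF Z_conc[OF j] Z_mean[OF j] s C, of "y i"] j by simp
  qed (use C in simp)
  then show ?thesis using i j by simp
qed

lemma prob_ZZ_le:
  assumes s: "s > 0" and i: "i < n" and j: "j < n" and ij: "i \<noteq> j"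
  shows "prob {\<omega> \<in> space M. \<bar>scal p (Z i \<omega>) (Z j \<omega>)\<bar> > s * L2_set (Z j \<omega>) {..<p}}
    \<le> C * exp (- c * s powr b)"
proof -
  have "indep_var (PiM {j} (\<lambda>_. Rp p)) (\<lambda>\<omega>. restrict (\<lambda>i. Z i \<omega>) {j}) (PiM {i} (\<lambda>_. Rp p)) (\<lambda>\<omega>. restrict (\<lambda>i. Z i \<omega>) {i})"
    using ij i j by (intro indep_var_restrict[OF Z_indep]) auto
  then have "indep_var (Rp p) ((\<lambda>x. x j) \<circ> (\<lambda>\<omega>. restrict (\<lambda>i. Z i \<omega>) {j})) (Rp p) ((\<lambda>x. x i) \<circ> (\<lambda>\<omega>. restrict (\<lambda>i. Z i \<omega>) {i}))"
    by (rule indep_var_compose) (auto intro: measurable_component_singleton)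
  then have ind: "indep_var (Rp p) (Z j) (Rp p) (Z i)" by (simp add: comp_def)
  have "prob {\<omega> \<in> space M. \<bar>scal p (Z j \<omega>) (Z i \<omega>)\<bar> > s * L2_set (Z j \<omega>) {..<p}}
      \<le> C * exp (- c * s powr b)"
  proof (rule indep_var_prob_le[OF ind, where E = "\<lambda>y z. \<bar>scal p y z\<bar> > s * L2_set y {..<p}"])
    show "Measurable.pred (Rp p \<Otimes>\<^sub>M Rp p) (\<lambda>(y, z). \<bar>scal p y z\<bar> > s * L2_set y {..<p})"
      by measurable
    show "prob {\<omega> \<in> space M. \<bar>scal p y (Z i \<omega>)\<bar> > s * L2_set y {..<p}}
        \<le> C * exp (- c * s powr b)" for y
      by (rule prob_scal_le[OF Z_conc[OF i] Z_mean[OF i] s C])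
  qed (use C in simp)
  then show ?thesis by (simp only: scal_commute)
qed

lemma prob_norm_Z_le:
  assumes "s > 0" "j < n"
  shows "prob {\<omega> \<in> space M. \<bar>L2_set (Z j \<omega>) {..<p} - (\<integral>\<omega>'. L2_set (Z j \<omega>') {..<p} \<partial>M)\<bar> > s}
    \<le> C * exp (- c * s powr b)"
  using Z_conc[OF assms(2)] lipschitz_L2_set[of p] assms(1) unfolding exp_concentrated_def by blast

lemma typical_measurable: "typical s \<in> events"
proof -
  have "typical s = {\<omega> \<in> space M. \<forall>i\<in>{..<n}. \<forall>j\<in>{..<n}.
     \<bar>scal p (Y i \<omega>) (Z j \<omega>)\<bar> \<le> s * L2_set (Y i \<omega>) {..<p} \<and>
     (i \<noteq> j \<longrightarrow> \<bar>scal p (Z i \<omega>) (Z j \<omega>)\<bar> \<le> s * L2_set (Z j \<omega>) {..<p}) \<and>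
     \<bar>L2_set (Z j \<omega>) {..<p} - (\<integral>\<omega>'. L2_set (Z j \<omega>') {..<p} \<partial>M)\<bar> \<le> s}"
    unfolding typical_def by auto
  also have "\<dots> \<in> events"
  proof (intro sets.sets_Collect_finite_All' finite_lessThan)
    fix i j assume "i \<in> {..<n}" "j \<in> {..<n}"
    then have [measurable]: "random_variable (Rp p) (Y i)" "random_variable (Rp p) (Z i)"
        "random_variable (Rp p) (Z j)"
      using Y_measurable Z_measurable by auto
    show "{\<omega> \<in> space M. \<bar>scal p (Y i \<omega>) (Z j \<omega>)\<bar> \<le> s * L2_set (Y i \<omega>) {..<p} \<and>
       (i \<noteq> j \<longrightarrow> \<bar>scal p (Z i \<omega>) (Z j \<omega>)\<bar> \<le> s * L2_set (Z j \<omega>) {..<p}) \<and>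
       \<bar>L2_set (Z j \<omega>) {..<p} - (\<integral>\<omega>'. L2_set (Z j \<omega>') {..<p} \<partial>M)\<bar> \<le> s} \<in> events"
      by measurable
  qed (use n in \<open>auto simp: lessThan_empty_iff\<close>)
  finally show ?thesis .
qed

text \<open>A union bound over \<open>n\<^sup>2\<close> pairs, with three events for each pair.\<close>

lemma prob_not_typical_le:
  assumes s: "s > 0"
  shows "prob (space M - typical s) \<le> 3 * (real n)\<^sup>2 * (C * exp (- c * s powr b))"
proof -
  let ?q = "C * exp (- c * s powr b)"
  define B1 where "B1 i j = {\<omega> \<in> space M. \<bar>scal p (Y i \<omega>) (Z j \<omega>)\<bar> > s * L2_set (Y i \<omega>) {..<p}}" for i j
  define B2 where "B2 i j = (if i = j then {} else
      {\<omega> \<in> space M. \<bar>scal p (Z i \<omega>) (Z j \<omega>)\<bar> > s * L2_set (Z j \<omega>) {..<p}})" for i j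
  define B3 where "B3 j =
      {\<omega> \<in> space M. \<bar>L2_set (Z j \<omega>) {..<p} - (\<integral>\<omega>'. L2_set (Z j \<omega>') {..<p} \<partial>M)\<bar> > s}" for j
  define B where "B ij = B1 (fst ij) (snd ij) \<union> B2 (fst ij) (snd ij) \<union> B3 (snd ij)" for ij
  let ?I = "{..<n} \<times> {..<n}"
  have ev: "B1 i j \<in> events" "B2 i j \<in> events" "B3 j \<in> events" if "i < n" "j < n" for i j
  proof -
    note [measurable] = Z_measurable[OF that(1)] Z_measurable[OF that(2)] Y_measurable[OF that(1)]
    show "B1 i j \<in> events" unfolding B1_def by measurable
    show "B2 i j \<in> events" unfolding B2_def by (cases "i = j") (simp, simp, measurable)
    have "{\<omega> \<in> space M. \<bar>L2_set (Z j \<omega>) {..<p} - m\<bar> > s} \<in> events" for m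
      by measurable
    then show "B3 j \<in> events" unfolding B3_def .
  qed
  have B: "prob (B ij) \<le> 3 * ?q" "B ij \<in> events" if "ij \<in> ?I" for ij
  proof -
    obtain i j where ij: "ij = (i, j)" "i < n" "j < n" using \<open>ij \<in> ?I\<close> by auto
    have "prob (B1 i j \<union> B2 i j \<union> B3 j) \<le> prob (B1 i j) + prob (B2 i j) + prob (B3 j)"
      using ev[OF ij(2,3)]
      by (meson add_right_mono measure_Un_le order_trans sets.Un)
    moreover have "prob (B1 i j) \<le> ?q" unfolding B1_def using s ij by (intro prob_YZ_le)
    moreover have "prob (B2 i j) \<le> ?q"
      unfolding B2_def using prob_ZZ_le[OF s ij(2,3)] C by simp
    moreover have "prob (B3 j) \<le> ?q" unfolding B3_def using s ij by (intro prob_norm_Z_le)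
    ultimately show "prob (B ij) \<le> 3 * ?q" unfolding B_def ij by simp
    show "B ij \<in> events" unfolding B_def ij using ev[OF ij(2,3)] by simp
  qed
  have "space M - typical s \<subseteq> (\<Union>ij\<in>?I. B ij)"
  proof
    fix \<omega> assume "\<omega> \<in> space M - typical s"
    then obtain i j where "i < n" "j < n" "\<omega> \<in> B1 i j \<union> B2 i j \<union> B3 j"
      unfolding typical_def B1_def B2_def B3_def by (auto simp: not_le)
    then show "\<omega> \<in> (\<Union>ij\<in>?I. B ij)" unfolding B_def by force
  qed
  then have "prob (space M - typical s) \<le> prob (\<Union>ij\<in>?I. B ij)"
    using B by (intro finite_measure_mono sets.finite_UN) auto
  also have "\<dots> \<le> (\<Sum>ij\<in>?I. prob (B ij))"
    using B by (intro finite_measure_subadditive_finite) auto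
  also have "\<dots> \<le> (\<Sum>ij\<in>?I. 3 * ?q)" using B by (intro sum_mono) auto
  also have "\<dots> = 3 * (real n)\<^sup>2 * ?q" by (simp add: power2_eq_square)
  finally show ?thesis .
qed

text \<open>The gap between the two moments is the variance of the norm, which concentration bounds
  independently of \<open>p\<close>.\<close>

lemma norm_Z_moments:
  assumes j: "j < n"
  defines "m \<equiv> \<integral>\<omega>. L2_set (Z j \<omega>) {..<p} \<partial>M"
  shows "0 \<le> m" "m\<^sup>2 \<le> \<nu> * real p" "\<nu> * real p \<le> m\<^sup>2 + tail_moment_bound C c b"
proof -
  note [measurable] = Z_measurable[OF j]
  show "0 \<le> m" unfolding m_def by simp
  have "integrable M (\<lambda>\<omega>. L2_set (Z j \<omega>) {..<p})"
    using Z_conc[OF j] lipschitz_L2_set[of p] unfolding exp_concentrated_def by blast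
  then have var: "variance (\<lambda>\<omega>. L2_set (Z j \<omega>) {..<p}) = \<nu> * real p - m\<^sup>2"
    unfolding m_def using nu[OF j] p by (subst variance_eq) auto
  then show "m\<^sup>2 \<le> \<nu> * real p"
    using variance_positive[of "\<lambda>\<omega>. L2_set (Z j \<omega>) {..<p}"] by linarith
  have "variance (\<lambda>\<omega>. L2_set (Z j \<omega>) {..<p}) \<le> tail_moment_bound C c b"
    using prob_norm_Z_le[OF _ j] C c b by (intro expectation_square_le_tail_moment_bound) auto
  with var show "\<nu> * real p \<le> m\<^sup>2 + tail_moment_bound C c b" by linarith
qed

text \<open>The choice of \<open>s\<close> makes each cross term at most \<open>\<tau>\<close>; \<open>N\<close> bounds the norms of the \<open>Y i\<close> on the
  event \<open>gram_max \<le> A\<close>, because the diagonal entries are the squared norms.\<close>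

lemma prob_gram_error_le:
  fixes A B \<tau> \<delta> :: real
  defines "N \<equiv> max (sqrt A) \<rho>"
  defines "s \<equiv> \<tau> * sqrt (real p) / (\<rho> * N)"
  assumes \<tau>: "0 < \<tau>" "\<tau> \<le> 1" and B: "\<nu> \<le> B"
    and \<delta>: "2 * \<tau> * (2 + sqrt B) + \<rho>\<^sup>2 * tail_moment_bound C c b / real p \<le> \<delta>"
  shows "prob {\<omega> \<in> space M. gram_error p n \<nu> (\<lambda>i. X i \<omega>) (\<lambda>i. Y i \<omega>) (\<lambda>i. R i \<omega>) > \<delta>}
    \<le> (1 - prob {\<omega> \<in> space M. gram_max p n (\<lambda>i. Y i \<omega>) \<le> A}) + 3 * (real n)\<^sup>2 * (C * exp (- c * s powr b))"
proof -
  note [measurable] = gram_max_measurable typical_measurable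
  define E where "E = {\<omega> \<in> space M. gram_max p n (\<lambda>i. Y i \<omega>) \<le> A}"
  have E [measurable]: "E \<in> events" unfolding E_def by measurable
  have N: "N \<ge> \<rho>" "N \<ge> sqrt A" "N \<ge> 1" unfolding N_def using \<rho> by auto
  have \<rho>N: "\<rho> * N \<ge> 1" using \<rho> N mult_mono[of 1 \<rho> 1 N] by simp
  have s0: "s > 0" unfolding s_def using \<tau> p \<rho>N by simp
  have "\<tau> * sqrt (real p) \<le> 1 * sqrt (real p)" using \<tau> by (intro mult_right_mono) auto
  also have "\<dots> \<le> (\<rho> * N) * sqrt (real p)" using \<rho>N by (intro mult_right_mono) auto
  finally have sp: "s \<le> sqrt (real p)" unfolding s_def using \<rho>N by (simp add: pos_divide_le_eq mult.commute)
  have small: "gram_error p n \<nu> (\<lambda>i. X i \<omega>) (\<lambda>i. Y i \<omega>) (\<lambda>i. R i \<omega>) \<le> \<delta>"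
    if \<omega>: "\<omega> \<in> E" "\<omega> \<in> typical s" for \<omega>
  proof (rule gram_error_le[OF n], rule order_trans[OF _ \<delta>])
    fix i j assume ij: "i < n" "j < n"
    have sp': "\<omega> \<in> space M" using \<omega> by (simp add: E_def)
    have Yle: "L2_set (Y k \<omega>) {..<p} \<le> N" if "k < n" for k
    proof -
      have "(L2_set (Y k \<omega>) {..<p})\<^sup>2 \<le> A"
        using gram_max_ge[OF that that, of p "\<lambda>i. Y i \<omega>"] \<omega>(1) by (simp add: E_def scal_self)
      then show ?thesis using N(2) real_le_rsqrt order_trans by blast
    qed
    show "\<bar>scal p (X i \<omega>) (X j \<omega>) -
        (scal p (Y i \<omega>) (Y j \<omega>) + (if i = j then 1 else 0) * \<nu> * (R i \<omega>)\<^sup>2)\<bar>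
      \<le> 2 * \<tau> * (2 + sqrt B) + \<rho>\<^sup>2 * tail_moment_bound C c b / real p"
    proof (rule approx_inner_error_le[OF p, where N = N and z = "\<lambda>k. Z k \<omega>" and s = s])
      show "s = \<tau> * sqrt (real p) / (\<rho> * N)" by (simp only: s_def)
    qed (use \<omega>(2) ij X[OF _ sp'] R_bound[OF _ sp'] Yle norm_Z_moments[OF ij(2)] \<rho> N(1) \<tau> sp B
         in \<open>auto simp: typical_def\<close>)
  qed
  have "prob {\<omega> \<in> space M. gram_error p n \<nu> (\<lambda>i. X i \<omega>) (\<lambda>i. Y i \<omega>) (\<lambda>i. R i \<omega>) > \<delta>}
      \<le> prob ((space M - E) \<union> (space M - typical s))"
    using small by (intro finite_measure_mono) (force, measurable)
  also have "\<dots> \<le> prob (space M - E) + prob (space M - typical s)"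
    by (intro measure_Un_le) measurable
  also have "prob (space M - E) = 1 - prob E" by (rule prob_compl) fact
  finally show ?thesis using prob_not_typical_le[OF s0] by (simp add: E_def)
qed

end

section \<open>Convergence in probability\<close>

theorem theorem2p4:
  fixes \<Omega> :: "nat \<Rightarrow> 'a measure"
    and n p :: "nat \<Rightarrow> nat"
    and X Y Z :: "nat \<Rightarrow> nat \<Rightarrow> 'a \<Rightarrow> (nat \<Rightarrow> real)"
    and R :: "nat \<Rightarrow> nat \<Rightarrow> 'a \<Rightarrow> real"
    and Rinf Mp \<nu> :: "nat \<Rightarrow> real"
    and C c0 b \<epsilon> :: real
  assumes "\<And>k. prob_space (\<Omega> k)"
    and "\<And>k. n k \<ge> 1" and "\<And>k. p k \<ge> 1"
    and "filterlim n at_top sequentially"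
    and "filterlim p at_top sequentially"
    and X: "\<And>k i \<omega>. i < n k \<Longrightarrow> \<omega> \<in> space (\<Omega> k) \<Longrightarrow>
        X k i \<omega> = (\<lambda>l\<in>{..<p k}. Y k i \<omega> l + R k i \<omega> * (Z k i \<omega> l / sqrt (real (p k))))"
    and Z_indep: "\<And>k. prob_space.indep_vars (\<Omega> k) (\<lambda>_. Rp (p k)) (Z k) {..<n k}"
    and Z_ident: "\<And>k i j. i < n k \<Longrightarrow> j < n k \<Longrightarrow>
        distr (\<Omega> k) (Rp (p k)) (Z k i) = distr (\<Omega> k) (Rp (p k)) (Z k j)"
    and Z_mean: "\<And>k i l. i < n k \<Longrightarrow> l < p k \<Longrightarrow>
        integrable (\<Omega> k) (\<lambda>\<omega>. Z k i \<omega> l) \<and> (\<integral>\<omega>. Z k i \<omega> l \<partial>\<Omega> k) = 0"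
    and Y_Z_indep: "\<And>k. prob_space.indep_var (\<Omega> k)
        (PiM {..<n k} (\<lambda>_. Rp (p k))) (\<lambda>\<omega>. \<lambda>i\<in>{..<n k}. Y k i \<omega>)
        (PiM {..<n k} (\<lambda>_. Rp (p k))) (\<lambda>\<omega>. \<lambda>i\<in>{..<n k}. Z k i \<omega>)"
    and R_Z_indep: "\<And>k. indep_rvs (\<Omega> k)
        (PiM {..<n k} (\<lambda>_. borel)) (\<lambda>\<omega>. \<lambda>i\<in>{..<n k}. R k i \<omega>)
        (PiM {..<n k} (\<lambda>_. Rp (p k))) (\<lambda>\<omega>. \<lambda>i\<in>{..<n k}. Z k i \<omega>)"
    and "\<And>k. Rinf k \<ge> 1"
    and R_bound: "\<And>k i \<omega>. i < n k \<Longrightarrow> \<omega> \<in> space (\<Omega> k) \<Longrightarrow> \<bar>R k i \<omega>\<bar> \<le> Rinf k"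
    and "C > 0" and "c0 > 0" and "b > 0"
    and Z_conc: "\<And>k i F. i < n k \<Longrightarrow> euclid_1_lipschitz (p k) F \<Longrightarrow>
        integrable (\<Omega> k) (\<lambda>\<omega>. F (Z k i \<omega>)) \<and>
        (\<forall>r>0. measure (\<Omega> k) {\<omega> \<in> space (\<Omega> k). \<bar>F (Z k i \<omega>) - (\<integral>\<omega>'. F (Z k i \<omega>') \<partial>\<Omega> k)\<bar> > r}
                 \<le> C * exp (- c0 * r powr b))"
    and nu: "\<And>k i. i < n k \<Longrightarrow>
        integrable (\<Omega> k) (\<lambda>\<omega>. (L2_set (Z k i \<omega>) {..<p k})\<^sup>2) \<and>
        \<nu> k = (\<integral>\<omega>. (L2_set (Z k i \<omega>) {..<p k})\<^sup>2 \<partial>\<Omega> k) / real (p k)"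
    and "Bseq \<nu>"
    and Mp: "(\<lambda>k. measure (\<Omega> k) {\<omega> \<in> space (\<Omega> k).
          (MAX (i, j)\<in>{..<n k} \<times> {..<n k}. \<bar>scal (p k) (Y k i \<omega>) (Y k j \<omega>)\<bar>) \<le> Mp k}) \<longlonglongrightarrow> 1"
    and "\<epsilon> > 0"
    and rate: "(\<lambda>k. max (sqrt (Mp k)) (Rinf k) *
          (Rinf k * (ln (real (n k)) + ln (real (n k)) powr \<epsilon>) powr (1 / b) / sqrt (real (p k)))) \<longlonglongrightarrow> 0"
  shows "tendsto_zero_in_prob \<Omega> (\<lambda>k \<omega>. ereal (MAX (i, j)\<in>{..<n k} \<times> {..<n k}.
            \<bar>scal (p k) (X k i \<omega>) (X k j \<omega>) -
             (scal (p k) (Y k i \<omega>) (Y k j \<omega>) + (if i = j then 1 else 0) * \<nu> k * (R k i \<omega>)\<^sup>2)\<bar>))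
       \<and> (\<forall>C1>0. \<forall>\<eta>>0.
            let J = (\<lambda>k. {- Mp k - \<eta> - (Rinf k)\<^sup>2 * \<nu> k .. Mp k + \<eta> + (Rinf k)\<^sup>2 * \<nu> k})
            in tendsto_zero_in_outer_prob \<Omega> (\<lambda>k \<omega>. SUP f\<in>{f :: real \<Rightarrow> real. C1-lipschitz_on (J k) f}.
                 ereal (frobenius_norm
                   (kernel_mat (p k) (n k) f (\<lambda>i. X k i \<omega>) -
                    approx_kernel_mat (p k) (n k) (\<nu> k) f (\<lambda>i. Y k i \<omega>) (\<lambda>i. R k i \<omega>)))))"
proof -
  note prob = assms(1) and n1 = assms(2) and p1 = assms(3) and n_lim = assms(4)
    and R_ge = \<open>\<And>k. Rinf k \<ge> 1\<close>
  have R_meas: "R k i \<in> borel_measurable (\<Omega> k)" if "i < n k" for k i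
    by (rule measurable_component_restrict[OF R_Z_indep[unfolded indep_rvs_def, THEN conjunct1] that])
  have Z_conc': "exp_concentrated (\<Omega> k) (p k) C c0 b (Z k i)" if "i < n k" for k i
    unfolding exp_concentrated_def by (intro allI impI Z_conc that)
  have nv: "noisy_vectors (\<Omega> k) (n k) (p k) (X k) (Y k) (Z k) (R k) (Rinf k) (\<nu> k) C c0 b" for k
    by (rule noisy_vectors.intro[OF prob noisy_vectors_axioms.intro])
       (fact n1 p1 X Z_indep Z_mean Y_Z_indep R_meas R_ge R_bound Z_conc' nu
          \<open>C > 0\<close> \<open>c0 > 0\<close> \<open>b > 0\<close>)+
  define err where "err k \<omega> = gram_error (p k) (n k) (\<nu> k) (\<lambda>i. X k i \<omega>) (\<lambda>i. Y k i \<omega>) (\<lambda>i. R k i \<omega>)" for k \<omega>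
  define ymax where "ymax k \<omega> = gram_max (p k) (n k) (\<lambda>i. Y k i \<omega>)" for k \<omega>
  have err_meas [measurable]: "err k \<in> borel_measurable (\<Omega> k)" for k
    unfolding err_def by (rule noisy_vectors.gram_error_measurable[OF nv])
  have ymax_meas [measurable]: "ymax k \<in> borel_measurable (\<Omega> k)" for k
    unfolding ymax_def by (rule noisy_vectors.gram_max_measurable[OF nv])
  have err_nonneg: "err k \<omega> \<ge> 0" for k \<omega>
    using gram_error_ge[of 0 "n k" 0 "p k" "\<lambda>i. X k i \<omega>" "\<lambda>i. Y k i \<omega>" "\<nu> k" "\<lambda>i. R k i \<omega>"] n1[of k]
    unfolding err_def by linarith
  have Mp': "(\<lambda>k. 1 - measure (\<Omega> k) {\<omega> \<in> space (\<Omega> k). ymax k \<omega> \<le> Mp k}) \<longlonglongrightarrow> 0"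
    using tendsto_diff[OF tendsto_const Mp, of 1] unfolding ymax_def gram_max_def
    by (simp only: diff_self)
  obtain B where "B > 0" and norm_\<nu>: "\<And>k. norm (\<nu> k) \<le> B"
    using \<open>Bseq \<nu>\<close> unfolding Bseq_def by blast
  have B: "B > 0" "\<nu> k \<le> B" for k
    using \<open>B > 0\<close> norm_\<nu>[of k] by auto

  have err_lim: "(\<lambda>k. measure (\<Omega> k) {\<omega> \<in> space (\<Omega> k). err k \<omega> > \<delta>}) \<longlonglongrightarrow> 0" if "\<delta> > 0" for \<delta>
  proof -
    define V where "V = tail_moment_bound C c0 b"
    \<comment> \<open>The cross terms and the fluctuation terms get half of \<open>\<delta>\<close>, the variance term the other half.\<close>
    define \<tau> where "\<tau> = min 1 (\<delta> / (4 * (2 + sqrt B)))"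
    have sB: "2 + sqrt B > 0" using B by (simp add: add_pos_nonneg)
    have \<tau>: "0 < \<tau>" "\<tau> \<le> 1" unfolding \<tau>_def using that sB by auto
    have "\<tau> \<le> \<delta> / (4 * (2 + sqrt B))" by (simp add: \<tau>_def)
    then have \<tau>\<delta>: "2 * \<tau> * (2 + sqrt B) \<le> \<delta> / 2" using sB by (simp add: field_simps)
    \<comment> \<open>Once \<open>a k < \<tau> \<sigma>\<close>, the exponent \<open>c0 s\<^sup>b\<close> is at least \<open>3 ln n\<close>, which beats the \<open>n\<^sup>2\<close> of
      the union bound by a factor \<open>n\<close>.\<close>
    define \<sigma> where "\<sigma> = (c0 / 3) powr (1 / b)"
    have \<sigma>: "\<sigma> > 0" "\<sigma> powr b = c0 / 3" using \<open>c0 > 0\<close> \<open>b > 0\<close> by (auto simp: \<sigma>_def powr_powr)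
    define N where "N k = max (sqrt (Mp k)) (Rinf k)" for k
    define L where "L k = ln (real (n k)) + ln (real (n k)) powr \<epsilon>" for k
    define s where "s k = \<tau> * sqrt (real (p k)) / (Rinf k * N k)" for k
    define a where "a k = N k * (Rinf k * L k powr (1 / b) / sqrt (real (p k)))" for k
    have a: "a \<longlonglongrightarrow> 0" using rate unfolding a_def N_def L_def .
    have "0 < n 0" using n1[of 0] by simp
    then have V: "V \<ge> 0" using noisy_vectors.norm_Z_moments(2,3)[OF nv] unfolding V_def
      by (smt (verit))
    have "filterlim (\<lambda>k. ln (real (n k))) at_top sequentially"
      using filterlim_compose[OF ln_at_top filterlim_compose[OF filterlim_real_sequentially n_lim]] .
    then have "eventually (\<lambda>k. ln (real (n k)) \<ge> 1) sequentially"
      by (simp add: filterlim_at_top)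
    moreover have "(\<lambda>k. a k * V) \<longlonglongrightarrow> 0" using tendsto_mult_left_zero[OF a] .
    then have "eventually (\<lambda>k. a k * V < \<delta> / 2) sequentially"
      by (rule order_tendstoD(2)) (use that in simp)
    moreover have "eventually (\<lambda>k. a k < \<tau> * \<sigma>) sequentially"
      using a by (rule order_tendstoD(2)) (use \<tau> \<sigma> in simp)
    ultimately have "eventually (\<lambda>k. measure (\<Omega> k) {\<omega> \<in> space (\<Omega> k). err k \<omega> > \<delta>} \<le>
       (1 - measure (\<Omega> k) {\<omega> \<in> space (\<Omega> k). ymax k \<omega> \<le> Mp k}) + 3 * C / real (n k)) sequentially"
    proof eventually_elim
      case (elim k)
      have sp: "sqrt (real (p k)) \<ge> 1" using p1[of k] by simp
      have R1: "Rinf k \<ge> 1" "Rinf k \<le> N k" using R_ge by (auto simp: N_def)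
      have L1: "L k \<ge> ln (real (n k))" "L k \<ge> 1" using elim(1) by (auto simp: L_def add_increasing2)
      then have g1: "L k powr (1 / b) \<ge> 1" using \<open>b > 0\<close> by (simp add: ge_one_powr_ge_zero)
      have "Rinf k \<le> Rinf k * L k powr (1 / b)"
        using mult_left_mono[OF g1, of "Rinf k"] R1 by simp
      then have RN: "(Rinf k)\<^sup>2 \<le> N k * (Rinf k * L k powr (1 / b))"
        unfolding power2_eq_square using R1 by (intro mult_mono) auto
      have "(Rinf k)\<^sup>2 / real (p k) \<le> (Rinf k)\<^sup>2 / sqrt (real (p k))"
      proof (rule divide_left_mono)
        show "sqrt (real (p k)) \<le> real (p k)"
          using sp mult_left_mono[OF sp, of "sqrt (real (p k))"] by simp
      qed (use sp in auto)
      also have "\<dots> \<le> a k" using divide_right_mono[OF RN, of "sqrt (real (p k))"] by (simp add: a_def)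
      finally have "(Rinf k)\<^sup>2 / real (p k) * V \<le> a k * V" using V by (rule mult_right_mono)
      then have \<delta>: "2 * \<tau> * (2 + sqrt B) + (Rinf k)\<^sup>2 * V / real (p k) \<le> \<delta>"
        using \<tau>\<delta> elim(2) by simp
      have pos: "Rinf k > 0" "N k > 0" "sqrt (real (p k)) > 0" using R1 sp by linarith+
      have s0: "s k \<ge> 0" unfolding s_def using pos \<tau> by simp
      have "\<tau> * L k powr (1 / b) = s k * a k"
        unfolding s_def a_def using pos by simp
      also have "\<dots> \<le> s k * (\<tau> * \<sigma>)"
        using elim(3) s0 by (intro mult_left_mono) auto
      also have "\<dots> = \<tau> * (s k * \<sigma>)" by simp
      finally have "\<tau> * L k powr (1 / b) \<le> \<tau> * (s k * \<sigma>)" .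
      then have "L k powr (1 / b) \<le> s k * \<sigma>" using \<tau> by simp
      then have "(L k powr (1 / b)) powr b \<le> (s k * \<sigma>) powr b"
        using \<open>b > 0\<close> by (intro powr_mono2) auto
      moreover have "(s k * \<sigma>) powr b = s k powr b * (c0 / 3)"
        unfolding \<sigma>(2)[symmetric] using \<sigma>(1) s0 by (simp add: powr_mult)
      moreover have "(L k powr (1 / b)) powr b = L k"
        using L1(2) \<open>b > 0\<close> by (simp add: powr_powr)
      ultimately have "L k \<le> s k powr b * (c0 / 3)" by (simp only:)
      then have "3 * L k \<le> c0 * s k powr b" by (simp add: mult.commute)
      then have "exp (- c0 * s k powr b) \<le> exp (- (3 * ln (real (n k))))" using L1 by simp
      also have "\<dots> = 1 / real (n k) ^ 3"
        using exp_of_nat_mult[of 3 "ln (real (n k))"] n1[of k] by (simp add: exp_minus inverse_eq_divide)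
      finally have "3 * (real (n k))\<^sup>2 * (C * exp (- c0 * s k powr b))
          \<le> 3 * (real (n k))\<^sup>2 * (C * (1 / real (n k) ^ 3))"
        using \<open>C > 0\<close> by (intro mult_left_mono) auto
      also have "\<dots> = 3 * C / real (n k)"
        using n1[of k] by (simp add: power2_eq_square power3_eq_cube)
      finally show ?case
        using noisy_vectors.prob_gram_error_le[OF nv \<tau> B(2) \<delta>[unfolded V_def], of "Mp k"]
        unfolding err_def ymax_def s_def N_def by linarith
    qed
    moreover have "(\<lambda>k. 3 * C / real (n k)) \<longlonglongrightarrow> 0"
      by (intro tendsto_divide_0[OF tendsto_const] filterlim_at_top_imp_at_infinity
          filterlim_compose[OF filterlim_real_sequentially n_lim])
    then have "(\<lambda>k. (1 - measure (\<Omega> k) {\<omega> \<in> space (\<Omega> k). ymax k \<omega> \<le> Mp k}) + 3 * C / real (n k)) \<longlonglongrightarrow> 0"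
      using tendsto_add[OF Mp', of _ 0] by simp
    ultimately show ?thesis
      by (rule tendsto_sandwich[OF always_eventually[OF allI[OF measure_nonneg]] _ tendsto_const])
  qed

  have gram_lim: "tendsto_zero_in_prob \<Omega> (\<lambda>k \<omega>. ereal (err k \<omega>))"
    unfolding tendsto_zero_in_prob_def using err_lim err_nonneg by simp
  have kernel_lim: "tendsto_zero_in_outer_prob \<Omega> (\<lambda>k \<omega>. SUP f\<in>{f :: real \<Rightarrow> real.
        C1-lipschitz_on {- Mp k - \<eta> - (Rinf k)\<^sup>2 * \<nu> k .. Mp k + \<eta> + (Rinf k)\<^sup>2 * \<nu> k} f}.
      ereal (frobenius_norm (kernel_mat (p k) (n k) f (\<lambda>i. X k i \<omega>) -
        approx_kernel_mat (p k) (n k) (\<nu> k) f (\<lambda>i. Y k i \<omega>) (\<lambda>i. R k i \<omega>))))"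
    (is "tendsto_zero_in_outer_prob \<Omega> ?S") if C1: "C1 > 0" and \<eta>: "\<eta> > 0" for C1 \<eta>
    unfolding tendsto_zero_in_outer_prob_def
  proof (intro exI conjI allI ballI)
    \<comment> \<open>Off the good event the supremum can be infinite, as the functions are unconstrained outside
      the interval.\<close>
    let ?D = "\<lambda>k \<omega>. if ymax k \<omega> \<le> Mp k \<and> err k \<omega> \<le> \<eta> then ereal (C1 * err k \<omega>) else \<infinity>"
    show "\<bar>?S k \<omega>\<bar> \<le> ?D k \<omega>" if \<omega>: "\<omega> \<in> space (\<Omega> k)" for k \<omega>
    proof (cases "ymax k \<omega> \<le> Mp k \<and> err k \<omega> \<le> \<eta>")
      case True
      have "?S k \<omega> \<le> ereal (C1 * err k \<omega>)"
      proof (rule SUP_least)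
        fix f assume "f \<in> {f :: real \<Rightarrow> real.
            C1-lipschitz_on {- Mp k - \<eta> - (Rinf k)\<^sup>2 * \<nu> k .. Mp k + \<eta> + (Rinf k)\<^sup>2 * \<nu> k} f}"
        then have f: "C1-lipschitz_on {- Mp k - \<eta> - (Rinf k)\<^sup>2 * \<nu> k .. Mp k + \<eta> + (Rinf k)\<^sup>2 * \<nu> k} f"
          by simp
        show "ereal (frobenius_norm (kernel_mat (p k) (n k) f (\<lambda>i. X k i \<omega>) -
            approx_kernel_mat (p k) (n k) (\<nu> k) f (\<lambda>i. Y k i \<omega>) (\<lambda>i. R k i \<omega>))) \<le> ereal (C1 * err k \<omega>)"
          unfolding ereal_less_eq err_def
          by (rule frobenius_kernel_diff_le[OF n1 f R_bound[OF _ \<omega>] noisy_vectors.nu_nonneg[OF nv]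
                less_imp_le[OF \<eta>] True[THEN conjunct1, unfolded ymax_def] True[THEN conjunct2, unfolded err_def]])
      qed
      moreover have "0 \<le> ?S k \<omega>"
      proof (rule SUP_upper2)
        show "(\<lambda>_. 0) \<in> {f :: real \<Rightarrow> real.
            C1-lipschitz_on {- Mp k - \<eta> - (Rinf k)\<^sup>2 * \<nu> k .. Mp k + \<eta> + (Rinf k)\<^sup>2 * \<nu> k} f}"
          using C1 by (auto intro!: lipschitz_onI)
      qed (simp add: frobenius_norm_def sum_nonneg)
      ultimately show ?thesis using True by simp
    next
      case False
      show ?thesis unfolding if_not_P[OF False] by simp
    qed
    show "tendsto_zero_in_prob \<Omega> ?D"
      unfolding tendsto_zero_in_prob_def
    proof (intro conjI allI impI)
      show "?D k \<in> borel_measurable (\<Omega> k)" for k by measurable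
      fix \<delta> :: real assume \<delta>: "\<delta> > 0"
      let ?u = "\<lambda>k. (1 - measure (\<Omega> k) {\<omega> \<in> space (\<Omega> k). ymax k \<omega> \<le> Mp k}) +
          measure (\<Omega> k) {\<omega> \<in> space (\<Omega> k). err k \<omega> > \<eta>} +
          measure (\<Omega> k) {\<omega> \<in> space (\<Omega> k). err k \<omega> > \<delta> / C1}"
      have "measure (\<Omega> k) {\<omega> \<in> space (\<Omega> k). \<bar>?D k \<omega>\<bar> > ereal \<delta>} \<le> ?u k" for k
      proof -
        interpret prob_space "\<Omega> k" by (rule prob)
        let ?E = "{\<omega> \<in> space (\<Omega> k). ymax k \<omega> \<le> Mp k}"
        let ?F = "\<lambda>t. {\<omega> \<in> space (\<Omega> k). err k \<omega> > t}"
        have "prob {\<omega> \<in> space (\<Omega> k). \<bar>?D k \<omega>\<bar> > ereal \<delta>} \<le> prob ((space (\<Omega> k) - ?E) \<union> ?F \<eta> \<union> ?F (\<delta> / C1))"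
        proof (rule finite_measure_mono)
          show "{\<omega> \<in> space (\<Omega> k). \<bar>?D k \<omega>\<bar> > ereal \<delta>}
              \<subseteq> (space (\<Omega> k) - ?E) \<union> ?F \<eta> \<union> ?F (\<delta> / C1)"
          proof
            fix \<omega> assume "\<omega> \<in> {\<omega> \<in> space (\<Omega> k). \<bar>?D k \<omega>\<bar> > ereal \<delta>}"
            then have \<omega>: "\<omega> \<in> space (\<Omega> k)" "\<bar>?D k \<omega>\<bar> > ereal \<delta>" by auto
            show "\<omega> \<in> (space (\<Omega> k) - ?E) \<union> ?F \<eta> \<union> ?F (\<delta> / C1)"
            proof (cases "ymax k \<omega> \<le> Mp k \<and> err k \<omega> \<le> \<eta>")
              case True
              then have "C1 * err k \<omega> > \<delta>" using \<omega>(2) C1 err_nonneg[of k \<omega>] by simp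
              then have "err k \<omega> > \<delta> / C1" using C1 by (simp add: pos_divide_less_eq mult.commute)
              then show ?thesis using \<omega>(1) by simp
            qed (use \<omega>(1) in auto)
          qed
        qed measurable
        also have "\<dots> \<le> prob ((space (\<Omega> k) - ?E) \<union> ?F \<eta>) + prob (?F (\<delta> / C1))"
          by (intro measure_Un_le) measurable
        also have "prob ((space (\<Omega> k) - ?E) \<union> ?F \<eta>) \<le> prob (space (\<Omega> k) - ?E) + prob (?F \<eta>)"
          by (intro measure_Un_le) measurable
        also have "prob (space (\<Omega> k) - ?E) = 1 - prob ?E" by (rule prob_compl) measurable
        finally show ?thesis by simp
      qed
      then have "eventually (\<lambda>k. measure (\<Omega> k) {\<omega> \<in> space (\<Omega> k). \<bar>?D k \<omega>\<bar> > ereal \<delta>} \<le> ?u k) sequentially"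
        by (intro always_eventually allI)
      moreover have "?u \<longlonglongrightarrow> 0"
        using tendsto_add[OF tendsto_add[OF Mp' err_lim[OF \<eta>]] err_lim[of "\<delta> / C1"]] \<delta> C1 by simp
      ultimately show "(\<lambda>k. measure (\<Omega> k) {\<omega> \<in> space (\<Omega> k). \<bar>?D k \<omega>\<bar> > ereal \<delta>}) \<longlonglongrightarrow> 0"
        by (rule tendsto_sandwich[OF always_eventually[OF allI[OF measure_nonneg]] _ tendsto_const])
    qed
  qed
  show ?thesis
    unfolding Let_def
    by (intro conjI allI impI gram_lim[unfolded err_def gram_error_def] kernel_lim)
qed

end
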